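(* Let $X$ be a finite dimensional real linear space, let $W\supset X$ be a finite dimensional linear space, and let $a(\cdot,\cdot)$ be a symmetric positive semidefinite bilinear form on $W$ that is positive definite on $X$. Let $V_1,\dots,V_M$ be subspaces of $W$ with $X\subset\sum_{k=1}^MV_k\subset W$, and let $Q_k:V_k\to X$, $k=1,\dots,M$, be linear operators. Let $B:X'\to X$ be the preconditioner $$B:r\mapsto u=\sum_{k=1}^M Q_kv_k,\qquad v_k\in V_k:\quad a(v_k,z_k)=\langle r,Q_kz_k\rangle\quad\forall z_k\in V_k .$$ Assume that the subspaces $V_k$ are energy orthogonal (pairwise $a$-orthogonal), that the operators $Q_k$ are projections ($Q_k^2=Q_k$), that $a(\cdot,\cdot)$ is positive definite on each space $V_k$, and that $$\forall u\in X:\quad\left[u=\sum_{k=1}^Mv_k,\ v_k\in V_k\right]\Longrightarrow u=\sum_{k=1}^MQ_kv_k .$$ Then $$\kappa=\frac{\lambda_{\max}(BA_X)}{\lambda_{\min}(BA_X)}\le\omega=\max_k\sup_{v_k\in V_k}\frac{\|Q_kv_k\|_a^2}{\|v_k\|_a^2}.$$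
   Context: $X'$ is the dual space of $X$ and $\langle\cdot,\cdot\rangle$ the duality pairing. $\|u\|_a=a(u,u)^{1/2}$ is the energy (semi)norm. $A_X:X\to X'$ is defined by $a(u,v)=\langle A_Xu,v\rangle$ for all $u,v\in X$. $\lambda_{\max}(BA_X)$, $\lambda_{\min}(BA_X)$ are the largest and smallest eigenvalues of $BA_X:X\to X$. A linear operator $Q_k$ is a projection if it is idempotent, i.e. $Q_k(Q_kv)=Q_kv$ for all $v\in V_k$ (so that $Q_kV_k\subset V_k$). Suprema are over nonzero $v_k$. *)

theory Defs
  imports "HOL-Analysis.Analysis"
begin

definition linear_on :: "'a::real_vector set \<Rightarrow> ('a \<Rightarrow> 'b::real_vector) \<Rightarrow> bool" where
  "linear_on S f \<longleftrightarrow>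
     (\<forall>x\<in>S. \<forall>y\<in>S. f (x + y) = f x + f y) \<and> (\<forall>c. \<forall>x\<in>S. f (c *\<^sub>R x) = c *\<^sub>R f x)"

text \<open>Functionals are made extensional so that each element of the dual of the subspace \<open>X\<close> is
  represented by exactly one function; the duality pairing of \<open>r\<close> and \<open>x\<close> is \<open>r x\<close>.\<close>

definition dual_space :: "'a::real_vector set \<Rightarrow> ('a \<Rightarrow> real) set" where
  "dual_space X = {r \<in> extensional X. linear_on X r}"

definition form_op :: "('a \<Rightarrow> 'a \<Rightarrow> real) \<Rightarrow> 'a::real_vector set \<Rightarrow> 'a \<Rightarrow> ('a \<Rightarrow> real)" where
  "form_op a X u = (\<lambda>v\<in>X. a u v)"

definition energy_norm :: "('a \<Rightarrow> 'a \<Rightarrow> real) \<Rightarrow> 'a \<Rightarrow> real" where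
  "energy_norm a u = sqrt (a u u)"

definition local_solution ::
    "('a \<Rightarrow> 'a \<Rightarrow> real) \<Rightarrow> 'a set \<Rightarrow> ('a \<Rightarrow> 'a) \<Rightarrow> ('a \<Rightarrow> real) \<Rightarrow> 'a \<Rightarrow> bool" where
  "local_solution a S q r v \<longleftrightarrow> v \<in> S \<and> (\<forall>z\<in>S. a v z = r (q z))"

text \<open>The description below is over the resulting \<open>u\<close>, not over the \<open>v k\<close>: if \<open>a\<close> is only
  semidefinite on \<open>V k\<close>, then \<open>v k\<close> need not be unique.\<close>

definition preconditioner ::
    "'a::real_vector set \<Rightarrow> ('a \<Rightarrow> 'a \<Rightarrow> real) \<Rightarrow> nat \<Rightarrow> (nat \<Rightarrow> 'a set) \<Rightarrow> (nat \<Rightarrow> 'a \<Rightarrow> 'a)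
      \<Rightarrow> ('a \<Rightarrow> real) \<Rightarrow> 'a" where
  "preconditioner X a M V Q =
     (\<lambda>r\<in>dual_space X.
        THE u. \<exists>v. (\<forall>k\<in>{1..M}. local_solution a (V k) (Q k) r (v k)) \<and> u = (\<Sum>k=1..M. Q k (v k)))"

definition projection_on :: "'a set \<Rightarrow> ('a \<Rightarrow> 'a) \<Rightarrow> bool" where
  "projection_on S q \<longleftrightarrow> q ` S \<subseteq> S \<and> (\<forall>v\<in>S. q (q v) = q v)"

definition eigenvalues_on :: "'a::real_vector set \<Rightarrow> ('a \<Rightarrow> 'a) \<Rightarrow> real set" where
  "eigenvalues_on X T = {l. \<exists>u\<in>X. u \<noteq> 0 \<and> T u = l *\<^sub>R u}"

definition lambda_max :: "'a::real_vector set \<Rightarrow> ('a \<Rightarrow> 'a) \<Rightarrow> real" where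
  "lambda_max X T = Max (eigenvalues_on X T)"

definition lambda_min :: "'a::real_vector set \<Rightarrow> ('a \<Rightarrow> 'a) \<Rightarrow> real" where
  "lambda_min X T = Min (eigenvalues_on X T)"

text \<open>The suprema are taken in the extended reals, so that they are meaningful without an a priori
  bound; a trivial space \<open>V k\<close> contributes \<open>-\<infinity>\<close>, i.e. nothing, to the maximum.\<close>

definition omega ::
    "('a \<Rightarrow> 'a \<Rightarrow> real) \<Rightarrow> nat \<Rightarrow> (nat \<Rightarrow> 'a::real_vector set) \<Rightarrow> (nat \<Rightarrow> 'a \<Rightarrow> 'a) \<Rightarrow> ereal" where
  "omega a M V Q =
     Max ((\<lambda>k. SUP v\<in>V k - {0}. ereal ((energy_norm a (Q k v))\<^sup>2 / (energy_norm a v)\<^sup>2)) ` {1..M})"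

end

theory Submission
  imports Defs "HOL-Computational_Algebra.Fundamental_Theorem_Algebra"
begin

text \<open>
  Let \<open>R k\<close>, with values in \<open>V k\<close>, be the adjoint of \<open>Q k\<close> with respect to \<open>a\<close>. The preconditioned
  operator is then \<open>T u = (\<Sum>k. Q k (R k u))\<close>, and \<open>a u (T w) = (\<Sum>k. a (R k u) (R k w))\<close>, so \<open>T\<close> is
  symmetric and its energy \<open>a u (T u)\<close> is the sum of the squared norms of the \<open>R k u\<close>. Every
  eigenvalue \<open>l\<close> of \<open>T\<close>, with eigenvector \<open>u\<close>, satisfies \<open>1 \<le> l \<le> \<omega>\<close>, which bounds the condition
  number by \<open>\<omega>\<close>.

  Lower bound (\<open>energy_le_preconditioned\<close>): by orthogonality, a decomposition of \<open>u\<close> into elements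
  of the \<open>V k\<close> has exactly the energy of \<open>u\<close>, and since it is reproduced by the \<open>Q k\<close>, duality gives
  \<open>a u u \<le> a u (T u) = l * a u u\<close>.

  Upper bound: since \<open>Q k\<close> maps \<open>V k\<close> into itself, the summands of \<open>T u\<close> are pairwise orthogonal.
  Hence \<open>l\<^sup>2 * a u u = a (T u) (T u)\<close> is the sum of the energies of the \<open>Q k (R k u)\<close>, which is at
  most \<open>\<omega>\<close> times the sum of the energies of the \<open>R k u\<close>, that is, \<open>\<omega> * l * a u u\<close>.

  The largest and smallest eigenvalues exist because the set of eigenvalues is finite
  (\<open>finite_eigenvalues_on\<close>) and nonempty (\<open>eigenvalues_on_nonempty\<close>). The ambient space is an
  abstract vector space without a topology, so instead of maximising a Rayleigh quotient the
  proof of nonemptiness factors a real polynomial that annihilates some vector.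
\<close>

section \<open>Bilinear forms on real vector spaces\<close>

lemmas bilinear_simps =
  bilinear_ladd bilinear_radd bilinear_lsub bilinear_rsub bilinear_lmul bilinear_rmul
  bilinear_lzero bilinear_rzero

lemma bilinear_sum_left: "bilinear a \<Longrightarrow> a (sum f S) y = (\<Sum>i\<in>S. a (f i) y)"
  by (rule linear_sum) (simp add: bilinear_def)

lemma bilinear_sum_right: "bilinear a \<Longrightarrow> a x (sum f S) = (\<Sum>i\<in>S. a x (f i))"
  by (rule linear_sum) (simp add: bilinear_def)

lemma form_sum_orthogonal:
  fixes a :: "'w::real_vector \<Rightarrow> 'w \<Rightarrow> real"
  assumes "bilinear a" "finite K"
    and "\<And>j k. j \<in> K \<Longrightarrow> k \<in> K \<Longrightarrow> j \<noteq> k \<Longrightarrow> a (x j) (y k) = 0"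
  shows "a (\<Sum>j\<in>K. x j) (\<Sum>k\<in>K. y k) = (\<Sum>k\<in>K. a (x k) (y k))"
proof -
  have "a (\<Sum>j\<in>K. x j) (\<Sum>k\<in>K. y k) = (\<Sum>j\<in>K. \<Sum>k\<in>K. a (x j) (y k))"
    by (simp add: assms(1) bilinear_sum_left bilinear_sum_right)
  also have "\<dots> = (\<Sum>j\<in>K. \<Sum>k\<in>K. if k = j then a (x j) (y k) else 0)"
    using assms(3) by (intro sum.cong refl) auto
  also have "\<dots> = (\<Sum>k\<in>K. a (x k) (y k))"
    using assms(2) by simp
  finally show ?thesis .
qed

lemma eq_if_form_eq:
  fixes a :: "'w::real_vector \<Rightarrow> 'w \<Rightarrow> real"
  assumes "bilinear a" "subspace S" "\<forall>v\<in>S. v \<noteq> 0 \<longrightarrow> 0 < a v v"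
    and "x \<in> S" "y \<in> S" "\<And>z. z \<in> S \<Longrightarrow> a x z = a y z"
  shows "x = y"
proof -
  have "x - y \<in> S" using assms by (simp add: subspace_diff)
  moreover have "a (x - y) (x - y) = 0"
    using assms(6)[OF \<open>x - y \<in> S\<close>] by (simp add: assms(1) bilinear_lsub)
  ultimately show ?thesis using assms(3) by fastforce
qed

text \<open>
  Riesz representation. In the induction step the new spanning vector \<open>b\<close> is replaced by its
  component \<open>d = b - p\<close> orthogonal to the old span; the projection \<open>p\<close> is itself the
  representer of \<open>a b\<close> there, so both uses of the induction hypothesis are needed.
\<close>

lemma riesz_span:
  fixes a :: "'w::real_vector \<Rightarrow> 'w \<Rightarrow> real"
  assumes a: "bilinear a" "\<forall>u v. a u v = a v u"
    and "finite B" "\<forall>v\<in>span B. v \<noteq> 0 \<longrightarrow> 0 < a v v" "linear_on (span B) \<phi>"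
  shows "\<exists>v\<in>span B. \<forall>z\<in>span B. a v z = \<phi> z"
  using assms(3-)
proof (induction B arbitrary: \<phi> rule: finite_induct)
  case empty
  have "\<phi> 0 = 0 *\<^sub>R \<phi> 0"
    using empty.prems(2) unfolding linear_on_def by (metis scaleR_zero_left span_zero)
  then show ?case by (simp add: a(1) bilinear_lzero)
next
  case (insert b B)
  have sub: "span B \<subseteq> span (insert b B)" by (simp add: span_mono subset_insertI)
  have pd: "\<forall>v\<in>span B. v \<noteq> 0 \<longrightarrow> 0 < a v v" using insert.prems(1) sub by blast
  have "linear_on (span B) \<phi>" using insert.prems(2) sub unfolding linear_on_def by blast
  from insert.IH[OF pd this] obtain w where w: "w \<in> span B" "\<forall>z\<in>span B. a w z = \<phi> z" by blast
  have "linear_on (span B) (a b)" by (simp add: linear_on_def a(1) bilinear_simps)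
  from insert.IH[OF pd this] obtain p where p: "p \<in> span B" "\<forall>z\<in>span B. a p z = a b z" by blast
  define d where "d = b - p"
  have d: "d \<in> span (insert b B)"
    unfolding d_def using p(1) sub by (blast intro: span_diff span_base)
  have orth: "a d z = 0" if "z \<in> span B" for z
    using p(2) that by (simp add: d_def a(1) bilinear_lsub)
  define v where "v = w + (\<phi> d / a d d) *\<^sub>R d"
  have v: "v \<in> span (insert b B)"
    unfolding v_def using w(1) sub d by (intro span_add span_mul) auto
  have dd: "\<phi> d / a d d * a d d = \<phi> d"
  proof (cases "d = 0")
    case True
    have "\<phi> (0 *\<^sub>R d) = 0 *\<^sub>R \<phi> d" using insert.prems(2) d unfolding linear_on_def by blast
    then show ?thesis using True by simp
  next
    case False
    then show ?thesis using insert.prems(1) d by force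
  qed
  have "a v z = \<phi> z" if z: "z \<in> span (insert b B)" for z
  proof -
    obtain t where t: "z - t *\<^sub>R b \<in> span B" using z span_breakdown_eq by blast
    define y where "y = z - t *\<^sub>R b + t *\<^sub>R p"
    have y: "y \<in> span B" unfolding y_def using t p(1) by (intro span_add span_mul)
    have zy: "z = y + t *\<^sub>R d" by (simp add: y_def d_def algebra_simps)
    have "a d y = 0" "a w d = 0" "a w y = \<phi> y"
      using orth[OF y] orth[OF w(1)] a(2)[rule_format, of w d] w(2) y by simp_all
    then have "a v z = \<phi> y + t * (\<phi> d / a d d * a d d)"
      by (simp add: v_def zy a(1) bilinear_simps)
    also have "\<dots> = \<phi> y + t *\<^sub>R \<phi> d" by (simp only: dd real_scaleR_def)
    also have "\<dots> = \<phi> z"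
      using insert.prems(2) y sub d unfolding zy linear_on_def by (metis span_mul subsetD)
    finally show ?thesis .
  qed
  then show ?case using v by blast
qed

lemma riesz_subspace:
  fixes a :: "'w::real_vector \<Rightarrow> 'w \<Rightarrow> real"
  assumes "finite S" "span S = (UNIV :: 'w set)"
    and "bilinear a" "\<forall>u v. a u v = a v u"
    and "subspace U" "\<forall>v\<in>U. v \<noteq> 0 \<longrightarrow> 0 < a v v" "linear_on U \<phi>"
  shows "\<exists>v\<in>U. \<forall>z\<in>U. a v z = \<phi> z"
proof -
  obtain B where B: "B \<subseteq> U" "independent B" "U \<subseteq> span B"
    by (rule maximal_independent_subset)
  have "finite B" using independent_span_bound[OF assms(1) B(2)] assms(2) by simp
  moreover have "span B = U" using B assms(5) by (meson span_subspace)
  ultimately show ?thesis using riesz_span[of a B \<phi>] assms by simp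
qed

section \<open>Spectra of operators that are symmetric for a form\<close>

definition poly_op :: "('w::real_vector \<Rightarrow> 'w) \<Rightarrow> real poly \<Rightarrow> 'w \<Rightarrow> 'w" where
  "poly_op T p u = (\<Sum>i\<le>degree p. coeff p i *\<^sub>R (T ^^ i) u)"

lemma poly_op_0 [simp]: "poly_op T 0 u = 0"
  by (simp add: poly_op_def)

lemma poly_op_pCons:
  assumes "linear T"
  shows "poly_op T (pCons c p) u = c *\<^sub>R u + T (poly_op T p u)"
proof (cases "p = 0")
  case True
  then show ?thesis using assms by (simp add: poly_op_def linear_0)
next
  case False
  then show ?thesis
    by (simp add: poly_op_def sum.atMost_Suc_shift linear_sum[OF assms] linear_scale[OF assms]
        del: sum.atMost_Suc)
qed

lemma poly_op_add:
  assumes "linear T"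
  shows "poly_op T (p + q) u = poly_op T p u + poly_op T q u"
  by (induction p q rule: poly_induct2)
     (simp_all add: poly_op_pCons[OF assms] linear_add[OF assms] scaleR_left_distrib)

lemma poly_op_smult:
  assumes "linear T"
  shows "poly_op T (smult c p) u = c *\<^sub>R poly_op T p u"
  by (induction p)
     (simp_all add: poly_op_pCons[OF assms] linear_scale[OF assms] scaleR_right_distrib)

lemma poly_op_mult:
  assumes "linear T"
  shows "poly_op T (p * q) u = poly_op T p (poly_op T q u)"
  by (induction p) (simp_all add: poly_op_pCons[OF assms] poly_op_add[OF assms] poly_op_smult[OF assms])

lemma poly_op_monom: "poly_op T (monom c i) u = c *\<^sub>R (T ^^ i) u"
proof (cases "c = 0")
  case False
  have "(\<Sum>j\<le>i. coeff (monom c i) j *\<^sub>R (T ^^ j) u) = (\<Sum>j\<le>i. if j = i then c *\<^sub>R (T ^^ i) u else 0)"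
    by (intro sum.cong refl) simp
  then show ?thesis using False by (simp add: poly_op_def degree_monom_eq)
qed simp

lemma poly_op_sum_monom:
  assumes "linear T" "finite I"
  shows "poly_op T (\<Sum>i\<in>I. monom (c i) i) u = (\<Sum>i\<in>I. c i *\<^sub>R (T ^^ i) u)"
  using assms(2) by induction (simp_all add: poly_op_add[OF assms(1)] poly_op_monom)

lemma poly_op_in_subspace:
  assumes "linear T" "subspace X" "T ` X \<subseteq> X" "u \<in> X"
  shows "poly_op T p u \<in> X"
proof (induction p)
  case 0
  show ?case using assms(2) by (simp add: subspace_0)
next
  case (pCons c p)
  then show ?case using assms by (auto simp: poly_op_pCons intro!: subspace_add subspace_scale)
qed

text \<open>In finite dimension the Krylov vectors \<open>u, T u, T\<^sup>2 u, \<dots>\<close> are linearly dependent.\<close>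

lemma annihilating_polynomial_exists:
  fixes T :: "'w::real_vector \<Rightarrow> 'w"
  assumes "finite S" "span S = (UNIV :: 'w set)" "linear T"
  shows "\<exists>p. p \<noteq> 0 \<and> poly_op T p u = 0"
proof -
  let ?I = "{..card S}"
  let ?f = "\<lambda>i. (T ^^ i) u"
  show ?thesis
  proof (cases "inj_on ?f ?I")
    case True
    then have "card (?f ` ?I) = Suc (card S)" by (simp add: card_image)
    then have "dependent (?f ` ?I)"
      using independent_span_bound[OF assms(1), of "?f ` ?I"] assms(2) by auto
    then obtain c where c: "\<exists>v\<in>?f ` ?I. c v \<noteq> 0" "(\<Sum>v\<in>?f ` ?I. c v *\<^sub>R v) = 0"
      by (subst (asm) dependent_finite) auto
    let ?p = "\<Sum>i\<in>?I. monom (c (?f i)) i"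
    have "poly_op T ?p u = 0"
      using c(2) by (simp add: poly_op_sum_monom[OF assms(3)] sum.reindex[OF True])
    moreover obtain j where j: "j \<in> ?I" "c (?f j) \<noteq> 0" using c(1) by blast
    then have "coeff ?p j \<noteq> 0" by (simp add: coeff_sum)
    then have "?p \<noteq> 0" by (metis coeff_0)
    ultimately show ?thesis by blast
  next
    case False
    then obtain i j where ij: "i \<noteq> j" "?f i = ?f j" unfolding inj_on_def by blast
    let ?p = "monom 1 i + monom (-1) j :: real poly"
    have "coeff ?p i \<noteq> 0" using ij(1) by simp
    then have "?p \<noteq> 0" by (metis coeff_0)
    moreover have "poly_op T ?p u = 0"
      using ij(2) by (simp add: poly_op_add[OF assms(3)] poly_op_monom)
    ultimately show ?thesis by blast
  qed
qed

text \<open>Evaluation at a complex number \<open>z\<close> is the case where \<open>T\<close> is multiplication by \<open>z\<close>.\<close>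

lemma poly_of_real_eq_poly_op: "poly (map_poly complex_of_real p) z = poly_op ((*) z) p 1"
proof -
  have "linear ((*) z)" by (rule linearI) (simp_all add: algebra_simps)
  then show ?thesis
    by (induction p) (simp_all add: map_poly_pCons poly_op_pCons scaleR_conv_of_real)
qed

text \<open>
  A nonconstant real polynomial has a complex root \<open>z\<close>. If \<open>z\<close> is not real, its minimal polynomial
  over the reals is \<open>(x - Re z)\<^sup>2 + (Im z)\<^sup>2\<close>, and the remainder on division by it is a real
  polynomial of degree at most one vanishing at \<open>z\<close>, hence zero.
\<close>

lemma real_poly_factor:
  fixes p :: "real poly"
  assumes "degree p \<noteq> 0"
  shows "(\<exists>x. [:- x, 1:] dvd p) \<or> (\<exists>x y. y \<noteq> 0 \<and> [:x\<^sup>2 + y\<^sup>2, - 2 * x, 1:] dvd p)"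
proof -
  have "degree (map_poly complex_of_real p) = degree p" by (rule degree_map_poly) simp
  then have "\<exists>z. poly (map_poly complex_of_real p) z = 0"
    using assms by (intro fundamental_theorem_of_algebra_alt) auto
  then obtain z :: complex where z: "poly_op ((*) z) p 1 = 0" by (auto simp: poly_of_real_eq_poly_op)
  have lin: "linear ((*) z)" by (rule linearI) (simp_all add: algebra_simps)
  note [simp] = poly_op_pCons[OF lin]
  define q where "q = (if Im z = 0 then [:- Re z, 1:] else [:(Re z)\<^sup>2 + (Im z)\<^sup>2, - 2 * Re z, 1:])"
  define r where "r = p mod q"
  have qz: "poly_op ((*) z) q w = 0" for w
    by (simp add: q_def complex_eq_iff power2_eq_square algebra_simps)
  have "p = q * (p div q) + r" by (simp add: r_def)
  then have "poly_op ((*) z) p 1 = poly_op ((*) z) r 1"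
    by (metis poly_op_add[OF lin] poly_op_mult[OF lin] qz add_0)
  then have rz: "poly_op ((*) z) r 1 = 0" using z by simp
  have dr: "r = 0 \<or> degree r < degree q" unfolding r_def by (rule degree_mod_less) (simp add: q_def)
  have "r = 0"
  proof (cases "Im z = 0")
    case True
    then have "degree r = 0" using dr by (auto simp: q_def)
    then obtain c where "r = [:c:]" by (rule degree_eq_zeroE)
    then show ?thesis using rz by simp
  next
    case False
    then have "degree r < 2" using dr by (auto simp: q_def)
    then have "degree r = 0 \<or> degree r = 1" by linarith
    then obtain c d where cd: "r = [:c, d:]"
      by (metis degree1_coeffs degree_eq_zeroE pCons_0_0)
    then have "c + Re z * d = 0" "Im z * d = 0" using rz by (simp_all add: complex_eq_iff algebra_simps)
    then show ?thesis using False cd by simp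
  qed
  then have "q dvd p" unfolding r_def by (simp add: mod_eq_0_iff_dvd)
  then show ?thesis by (cases "Im z = 0") (auto simp: q_def)
qed

text \<open>
  Take an annihilating polynomial of some nonzero vector and split off a factor from
  \<open>real_poly_factor\<close>. A linear factor either yields an eigenvector or can be dropped. A quadratic
  factor can always be dropped: for symmetric \<open>T\<close> the operator \<open>(T - x)\<^sup>2 + y\<^sup>2\<close> with \<open>y \<noteq> 0\<close> is
  positive definite, hence injective.
\<close>

lemma eigenvalue_if_annihilated:
  fixes a :: "'w::real_vector \<Rightarrow> 'w \<Rightarrow> real"
  assumes a: "bilinear a" "\<forall>v\<in>X. v \<noteq> 0 \<longrightarrow> 0 < a v v"
    and X: "subspace X" "T ` X \<subseteq> X"
    and T: "linear T" "\<And>v w. a (T v) w = a v (T w)"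
    and "p \<noteq> 0" "u \<in> X" "u \<noteq> 0" "poly_op T p u = 0"
  shows "eigenvalues_on X T \<noteq> {}"
  using assms(7,10)
proof (induction "degree p" arbitrary: p rule: less_induct)
  case less
  have nonneg: "0 \<le> a v v" if "v \<in> X" for v
    using a(2) that by (cases "v = 0") (auto simp: a(1) bilinear_lzero order.strict_iff_order)
  have cofactor: "eigenvalues_on X T \<noteq> {}"
    if "p = q * s" "degree q \<noteq> 0" "poly_op T s u = 0" for q s
  proof -
    have "q \<noteq> 0" "s \<noteq> 0" using less.prems that by auto
    then have "degree s < degree p" using that by (simp add: degree_mult_eq)
    then show ?thesis using less.hyps \<open>s \<noteq> 0\<close> that(3) by blast
  qed
  have "degree p \<noteq> 0"
  proof
    assume "degree p = 0"
    then obtain c where "p = [:c:]" by (metis degree_eq_zeroE)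
    then show False using less.prems assms(9) T(1) by (simp add: poly_op_pCons linear_0)
  qed
  from real_poly_factor[OF this] consider
    x s where "p = [:- x, 1:] * s" |
    x y s where "y \<noteq> 0" "p = [:x\<^sup>2 + y\<^sup>2, - 2 * x, 1:] * s"
    by (auto simp: dvd_def)
  then show ?case
  proof cases
    case 1
    define w where "w = poly_op T s u"
    have "w \<in> X" unfolding w_def using assms by (intro poly_op_in_subspace) auto
    have "T w = x *\<^sub>R w"
      using less.prems(2) T(1) unfolding 1 poly_op_mult[OF T(1)] w_def[symmetric]
      by (simp add: poly_op_pCons linear_0)
    then show ?thesis
      using \<open>w \<in> X\<close> cofactor[OF 1] unfolding w_def eigenvalues_on_def by auto
  next
    case 2
    define w where "w = poly_op T s u"
    have "w \<in> X" unfolding w_def using assms by (intro poly_op_in_subspace) auto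
    define e where "e = T w - x *\<^sub>R w"
    have "e \<in> X" unfolding e_def using \<open>w \<in> X\<close> X by (auto intro!: subspace_diff subspace_scale)
    have "(x\<^sup>2 + y\<^sup>2) *\<^sub>R w + T ((- 2 * x) *\<^sub>R w + T w) = 0"
      using less.prems(2) T(1) unfolding 2 poly_op_mult[OF T(1)] w_def[symmetric]
      by (simp add: poly_op_pCons linear_0)
    then have "T e - x *\<^sub>R e + y\<^sup>2 *\<^sub>R w = 0"
      unfolding e_def linear_add[OF T(1)] linear_diff[OF T(1)] linear_scale[OF T(1)]
      by (simp add: algebra_simps power2_eq_square flip: scaleR_2)
    then have "0 = a (T e - x *\<^sub>R e + y\<^sup>2 *\<^sub>R w) w" by (simp add: a(1) bilinear_lzero)
    also have "\<dots> = a e e + y\<^sup>2 * a w w"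
    proof -
      have "a e (T w - x *\<^sub>R w) = a (T e) w - x * a e w"
        by (simp add: a(1) bilinear_simps T(2))
      then show ?thesis unfolding e_def[symmetric] by (simp add: a(1) bilinear_simps)
    qed
    finally have "y\<^sup>2 * a w w \<le> 0" using nonneg[OF \<open>e \<in> X\<close>] by linarith
    then have "a w w \<le> 0" using 2(1) by (simp add: mult_le_0_iff)
    then have "w = 0" using a(2) \<open>w \<in> X\<close> by force
    then show ?thesis using cofactor[OF 2(2)] by (simp add: w_def)
  qed
qed

lemma eigenvalues_on_nonempty:
  fixes a :: "'w::real_vector \<Rightarrow> 'w \<Rightarrow> real"
  assumes "finite S" "span S = (UNIV :: 'w set)"
    and "bilinear a" "\<forall>v\<in>X. v \<noteq> 0 \<longrightarrow> 0 < a v v"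
    and X: "subspace X" "X \<noteq> {0}" and "T ` X \<subseteq> X"
    and "linear T" "\<And>v w. a (T v) w = a v (T w)"
  shows "eigenvalues_on X T \<noteq> {}"
proof -
  have "0 \<in> X" using X(1) by (rule subspace_0)
  with X(2) obtain u where "u \<in> X" "u \<noteq> 0" by auto
  moreover obtain p where "p \<noteq> 0" "poly_op T p u = 0"
    using annihilating_polynomial_exists[OF assms(1,2) \<open>linear T\<close>, of u] by auto
  ultimately show ?thesis
    using eigenvalue_if_annihilated[OF assms(3,4) X(1) assms(7-9), of p u] by simp
qed

text \<open>
  Eigenvectors for distinct eigenvalues are orthogonal, hence linearly independent, so that there
  are at most as many eigenvalues as dimensions.
\<close>

lemma finite_eigenvalues_on:
  fixes a :: "'w::real_vector \<Rightarrow> 'w \<Rightarrow> real"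
  assumes "finite S" "span S = (UNIV :: 'w set)"
    and a: "bilinear a" "\<forall>v\<in>X. v \<noteq> 0 \<longrightarrow> 0 < a v v"
    and T: "\<And>v w. a (T v) w = a v (T w)"
  shows "finite (eigenvalues_on X T)"
proof -
  let ?E = "eigenvalues_on X T"
  obtain f where f: "\<forall>l\<in>?E. f l \<in> X \<and> f l \<noteq> 0 \<and> T (f l) = l *\<^sub>R f l"
    using bchoice[of ?E "\<lambda>l u. u \<in> X \<and> u \<noteq> 0 \<and> T u = l *\<^sub>R u"] unfolding eigenvalues_on_def by blast
  have orth: "a (f l) (f m) = 0" if "l \<in> ?E" "m \<in> ?E" "l \<noteq> m" for l m
  proof -
    have "l * a (f l) (f m) = m * a (f l) (f m)"
      using T[of "f l" "f m"] f that by (simp add: a(1) bilinear_simps)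
    then show ?thesis using that by simp
  qed
  have pos: "a (f l) (f l) > 0" if "l \<in> ?E" for l using a(2) f that by blast
  have inj: "inj_on f ?E"
    by (rule inj_onI) (metis orth pos order_less_irrefl)
  have "independent (f ` ?E)"
    unfolding independent_explicit_finite_subsets
  proof (intro allI impI ballI)
    fix A c v
    assume A: "A \<subseteq> f ` ?E" "finite A" "(\<Sum>v\<in>A. c v *\<^sub>R v) = 0" "v \<in> A"
    have "0 = a (\<Sum>w\<in>A. c w *\<^sub>R w) v" using A(3) by (simp add: a(1) bilinear_lzero)
    also have "\<dots> = (\<Sum>w\<in>A. c w * a w v)" by (simp add: a(1) bilinear_sum_left bilinear_lmul)
    also have "\<dots> = (\<Sum>w\<in>A. if w = v then c v * a v v else 0)"
    proof (intro sum.cong refl)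
      fix w assume "w \<in> A"
      show "c w * a w v = (if w = v then c v * a v v else 0)"
      proof (cases "w = v")
        case False
        obtain l m where "w = f l" "v = f m" "l \<in> ?E" "m \<in> ?E" using A(1,4) \<open>w \<in> A\<close> by blast
        then show ?thesis using False orth[of l m] by auto
      qed simp
    qed
    also have "\<dots> = c v * a v v" using A(2,4) by simp
    finally show "c v = 0" using pos A(1,4) by force
  qed
  then have "finite (f ` ?E)" using independent_span_bound[OF assms(1)] assms(2) by blast
  then show ?thesis using inj by (simp add: finite_image_iff)
qed

section \<open>The preconditioned operator\<close>

text \<open>
  If \<open>R k\<close> is the adjoint of \<open>Q k\<close>, then the local solution for the functional \<open>a u\<close> is \<open>R k u\<close>, and
  the preconditioned operator is the sum of the \<open>Q k R k\<close>. Here \<open>u\<close> may lie outside \<open>X\<close>, because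
  \<open>form_op a X u\<close> is a functional on \<open>X\<close> for every \<open>u\<close>; so the operator is globally linear, as the
  spectral lemmas require.
\<close>

lemma preconditioner_form_op:
  fixes a :: "'w::real_vector \<Rightarrow> 'w \<Rightarrow> real"
  assumes a: "bilinear a" and X: "subspace X"
    and V: "\<forall>k\<in>{1..M}. subspace (V k)" "\<forall>k\<in>{1..M}. \<forall>v\<in>V k. v \<noteq> 0 \<longrightarrow> 0 < a v v"
    and Q: "\<forall>k\<in>{1..M}. Q k ` V k \<subseteq> X"
    and R: "\<forall>k\<in>{1..M}. R k u \<in> V k \<and> (\<forall>z\<in>V k. a (R k u) z = a u (Q k z))"
  shows "preconditioner X a M V Q (form_op a X u) = (\<Sum>k=1..M. Q k (R k u))"
proof -
  have dual: "form_op a X u \<in> dual_space X"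
    using X by (auto simp: dual_space_def form_op_def linear_on_def a bilinear_simps
        subspace_add subspace_scale)
  have loc: "local_solution a (V k) (Q k) (form_op a X u) v \<longleftrightarrow> v = R k u" if k: "k \<in> {1..M}" for k v
  proof -
    have "form_op a X u (Q k z) = a (R k u) z" if "z \<in> V k" for z
      using Q R k that by (auto simp: form_op_def image_subset_iff)
    then have "local_solution a (V k) (Q k) (form_op a X u) v \<longleftrightarrow>
        v \<in> V k \<and> (\<forall>z\<in>V k. a v z = a (R k u) z)"
      by (auto simp: local_solution_def)
    also have "\<dots> \<longleftrightarrow> v = R k u"
    proof
      assume v: "v \<in> V k \<and> (\<forall>z\<in>V k. a v z = a (R k u) z)"
      show "v = R k u"
        by (rule eq_if_form_eq[OF a, of "V k"]) (use V R k v in auto)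
    qed (use R k in auto)
    finally show ?thesis .
  qed
  have "(THE x. \<exists>v. (\<forall>k\<in>{1..M}. local_solution a (V k) (Q k) (form_op a X u) (v k)) \<and>
      x = (\<Sum>k=1..M. Q k (v k))) = (\<Sum>k=1..M. Q k (R k u))"
  proof (rule the_equality)
    show "\<exists>v. (\<forall>k\<in>{1..M}. local_solution a (V k) (Q k) (form_op a X u) (v k)) \<and>
      (\<Sum>k=1..M. Q k (R k u)) = (\<Sum>k=1..M. Q k (v k))"
      using loc by (intro exI[of _ "\<lambda>k. R k u"]) simp
  qed (auto simp: loc intro!: sum.cong)
  then show ?thesis using dual by (simp add: preconditioner_def)
qed

text \<open>
  A symmetric operator is automatically linear when the form separates the points of its
  range. This replaces checking linearity of the local solutions.
\<close>

lemma linear_if_symmetric: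
  fixes a :: "'w::real_vector \<Rightarrow> 'w \<Rightarrow> real"
  assumes a: "bilinear a" "\<forall>v\<in>X. v \<noteq> 0 \<longrightarrow> 0 < a v v"
    and X: "subspace X" "range T \<subseteq> X"
    and T: "\<And>v w. a (T v) w = a v (T w)"
  shows "linear T"
proof (rule linearI)
  have "T u \<in> X" for u using X(2) by blast
  note mem = this subspace_add[OF X(1)] subspace_scale[OF X(1)]
  show "T (x + y) = T x + T y" for x y
    by (rule eq_if_form_eq[OF a(1) X(1) a(2)]) (simp_all add: mem T a(1) bilinear_simps)
  show "T (c *\<^sub>R x) = c *\<^sub>R T x" for c x
    by (rule eq_if_form_eq[OF a(1) X(1) a(2)]) (simp_all add: mem T a(1) bilinear_simps)
qed

text \<open>
  Write \<open>u\<close> as the sum of \<open>v k\<close>, hence also as the sum of the \<open>Q k (v k)\<close>, and let \<open>y\<close> be the sum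
  of the \<open>R k u\<close>. Adjointness and orthogonality give \<open>a u u = a u y\<close>, so \<open>u\<close> is not longer than \<open>y\<close>.
\<close>

lemma energy_le_preconditioned:
  fixes a :: "'w::real_vector \<Rightarrow> 'w \<Rightarrow> real"
  assumes a: "bilinear a" "\<forall>u v. a u v = a v u" "\<forall>u. 0 \<le> a u u"
    and K: "finite K" and orth: "\<And>j k v w. j \<in> K \<Longrightarrow> k \<in> K \<Longrightarrow> j \<noteq> k \<Longrightarrow> v \<in> V j \<Longrightarrow> w \<in> V k \<Longrightarrow> a v w = 0"
    and R: "\<And>k. k \<in> K \<Longrightarrow> R k \<in> V k" "\<And>k z. k \<in> K \<Longrightarrow> z \<in> V k \<Longrightarrow> a (R k) z = a u (Q k z)"
    and v: "\<And>k. k \<in> K \<Longrightarrow> v k \<in> V k" "u = (\<Sum>k\<in>K. v k)" "u = (\<Sum>k\<in>K. Q k (v k))"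
  shows "a u u \<le> (\<Sum>k\<in>K. a (R k) (R k))"
proof -
  define y where "y = (\<Sum>k\<in>K. R k)"
  have "a u u = a u (\<Sum>k\<in>K. Q k (v k))" using v(3) by simp
  also have "\<dots> = (\<Sum>k\<in>K. a (R k) (v k))"
    using R(2) v(1) by (simp add: a(1) bilinear_sum_right)
  also have "\<dots> = a y u"
    unfolding y_def v(2) using form_sum_orthogonal[OF a(1) K, of R v] orth R(1) v(1) by simp
  finally have "a u u = a u y" using a(2) by simp
  moreover have "0 \<le> a (u - y) (u - y)" using a(3) by blast
  then have "0 \<le> a u u - a u y - a u y + a y y"
    using a(2) by (simp add: a(1) bilinear_simps)
  ultimately have "a u u \<le> a y y" by simp
  also have "a y y = (\<Sum>k\<in>K. a (R k) (R k))"
    unfolding y_def using form_sum_orthogonal[OF a(1) K, of R R] orth R(1) by simp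
  finally show ?thesis .
qed

text \<open>
  Comparing \<open>omega\<close> with an arbitrary real \<open>c\<close> avoids arithmetic with infinite values; for \<open>v = 0\<close>,
  which the supremum leaves out, both sides vanish.
\<close>

lemma energy_le_if_omega_le:
  fixes a :: "'w::real_vector \<Rightarrow> 'w \<Rightarrow> real"
  assumes a: "bilinear a" "\<forall>u. 0 \<le> a u u"
    and k: "k \<in> {1..M}" and V: "\<forall>v\<in>V k. v \<noteq> 0 \<longrightarrow> 0 < a v v" and lin: "linear_on (V k) (Q k)"
    and om: "omega a M V Q \<le> ereal c" and v: "v \<in> V k"
  shows "a (Q k v) (Q k v) \<le> c * a v v"
proof (cases "v = 0")
  case True
  have "Q k (0 *\<^sub>R v) = 0 *\<^sub>R Q k v" using lin v unfolding linear_on_def by blast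
  then show ?thesis using True by (simp add: a(1) bilinear_lzero)
next
  case False
  have "ereal ((energy_norm a (Q k v))\<^sup>2 / (energy_norm a v)\<^sup>2)
      \<le> (SUP v\<in>V k - {0}. ereal ((energy_norm a (Q k v))\<^sup>2 / (energy_norm a v)\<^sup>2))"
    using v False by (intro SUP_upper) auto
  also have "\<dots> \<le> omega a M V Q" unfolding omega_def using k by (intro Max_ge) auto
  also note om
  finally have "a (Q k v) (Q k v) / a v v \<le> c" using a(2) by (simp add: energy_norm_def)
  then show ?thesis using V v False by (simp add: divide_le_eq)
qed

theorem corollary4:
  fixes a :: "'w::real_vector \<Rightarrow> 'w \<Rightarrow> real"
    and X :: "'w set"
    and M :: nat
    and V :: "nat \<Rightarrow> 'w set"
    and Q :: "nat \<Rightarrow> 'w \<Rightarrow> 'w"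
  assumes W_finite_dim: "\<exists>S::'w set. finite S \<and> span S = UNIV"
    and X_subspace: "subspace X" and X_nontrivial: "X \<noteq> {0}"
    and a_bilinear: "bilinear a"
    and a_sym: "\<forall>u v. a u v = a v u"
    and a_semidef: "\<forall>u. 0 \<le> a u u"
    and a_posdef_X: "\<forall>u\<in>X. u \<noteq> 0 \<longrightarrow> 0 < a u u"
    and V_subspace: "\<forall>k\<in>{1..M}. subspace (V k)"
    and X_sub_sum: "X \<subseteq> {\<Sum>k=1..M. v k | v. \<forall>k\<in>{1..M}. v k \<in> V k}"
    and Q_linear: "\<forall>k\<in>{1..M}. linear_on (V k) (Q k)"
    and Q_into_X: "\<forall>k\<in>{1..M}. Q k ` V k \<subseteq> X"
    and V_orthogonal:
      "\<forall>j\<in>{1..M}. \<forall>k\<in>{1..M}. j \<noteq> k \<longrightarrow> (\<forall>v\<in>V j. \<forall>w\<in>V k. a v w = 0)"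
    and Q_projection: "\<forall>k\<in>{1..M}. projection_on (V k) (Q k)"
    and a_posdef_V: "\<forall>k\<in>{1..M}. \<forall>v\<in>V k. v \<noteq> 0 \<longrightarrow> 0 < a v v"
    and decomposition:
      "\<forall>u\<in>X. \<forall>v. (\<forall>k\<in>{1..M}. v k \<in> V k) \<and> u = (\<Sum>k=1..M. v k)
         \<longrightarrow> u = (\<Sum>k=1..M. Q k (v k))"
  shows "0 < lambda_min X (preconditioner X a M V Q \<circ> form_op a X) \<and>
    ereal (lambda_max X (preconditioner X a M V Q \<circ> form_op a X) /
           lambda_min X (preconditioner X a M V Q \<circ> form_op a X)) \<le> omega a M V Q"
proof -
  let ?K = "{1..M}"
  define T where "T = preconditioner X a M V Q \<circ> form_op a X"
  let ?E = "eigenvalues_on X T"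
  obtain S :: "'w set" where S: "finite S" "span S = UNIV" using W_finite_dim by blast
  have orth: "a v w = 0" if "j \<in> ?K" "k \<in> ?K" "j \<noteq> k" "v \<in> V j" "w \<in> V k" for j k v w
    using V_orthogonal that by blast
  have "\<exists>v\<in>V k. \<forall>z\<in>V k. a v z = a u (Q k z)" if k: "k \<in> ?K" for k u
  proof (rule riesz_subspace[OF S a_bilinear a_sym])
    show "linear_on (V k) (\<lambda>z. a u (Q k z))"
      using Q_linear k by (simp add: linear_on_def a_bilinear bilinear_simps)
  qed (use V_subspace a_posdef_V k in auto)
  then obtain R where R: "\<And>k u. k \<in> ?K \<Longrightarrow> R k u \<in> V k"
      "\<And>k u z. k \<in> ?K \<Longrightarrow> z \<in> V k \<Longrightarrow> a (R k u) z = a u (Q k z)"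
    by metis
  have T_eq: "T u = (\<Sum>k\<in>?K. Q k (R k u))" for u
    using preconditioner_form_op[OF a_bilinear X_subspace V_subspace a_posdef_V Q_into_X, of R u] R
    by (simp add: T_def)
  have TX: "range T \<subseteq> X"
    unfolding image_subset_iff T_eq using Q_into_X R(1)
    by (intro ballI subspace_sum[OF X_subspace]) blast
  have aT: "a u (T w) = (\<Sum>k\<in>?K. a (R k u) (R k w))" for u w
    unfolding T_eq by (simp add: a_bilinear bilinear_sum_right R)
  have sym: "a (T u) w = a u (T w)" for u w
  proof -
    have "a (T u) w = a w (T u)" using a_sym by blast
    also have "\<dots> = (\<Sum>k\<in>?K. a (R k u) (R k w))"
      unfolding aT using a_sym by (intro sum.cong refl) blast
    finally show ?thesis unfolding aT .
  qed
  have lin: "linear T" by (rule linear_if_symmetric[OF a_bilinear a_posdef_X X_subspace TX sym])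
  have fin: "finite ?E" by (rule finite_eigenvalues_on[OF S a_bilinear a_posdef_X sym])
  have ne: "?E \<noteq> {}"
    by (rule eigenvalues_on_nonempty[OF S a_bilinear a_posdef_X X_subspace X_nontrivial _ lin sym])
       (use TX in auto)

  have lower: "1 \<le> l" if l: "l \<in> ?E" for l
  proof -
    obtain u where u: "u \<in> X" "u \<noteq> 0" "T u = l *\<^sub>R u" using l by (auto simp: eigenvalues_on_def)
    obtain v where v: "\<And>k. k \<in> ?K \<Longrightarrow> v k \<in> V k" "u = (\<Sum>k\<in>?K. v k)" using X_sub_sum u(1) by blast
    moreover have "u = (\<Sum>k\<in>?K. Q k (v k))" using decomposition u(1) v by blast
    ultimately have "a u u \<le> (\<Sum>k\<in>?K. a (R k u) (R k u))"
      by (intro energy_le_preconditioned[where V = V and Q = Q and v = v])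
         (use a_bilinear a_sym a_semidef orth R in blast)+
    also have "\<dots> = a u (T u)" by (rule aT[symmetric])
    also have "\<dots> = l * a u u" by (simp only: u(3) bilinear_rmul[OF a_bilinear] real_scaleR_def)
    finally show ?thesis using a_posdef_X u(1,2) by simp
  qed

  have upper: "l \<le> c" if l: "l \<in> ?E" and om: "omega a M V Q \<le> ereal c" for l c
  proof -
    obtain u where u: "u \<in> X" "u \<noteq> 0" "T u = l *\<^sub>R u" using l by (auto simp: eigenvalues_on_def)
    have QV: "Q k (R k u) \<in> V k" if "k \<in> ?K" for k
      using Q_projection R(1) that unfolding projection_on_def by blast
    have "l * (l * a u u) = a (T u) (T u)"
      by (simp only: u(3) bilinear_simps[OF a_bilinear] real_scaleR_def)
    also have "\<dots> = (\<Sum>k\<in>?K. a (Q k (R k u)) (Q k (R k u)))"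
      \<comment> \<open>The summands of \<open>T u\<close> are orthogonal because \<open>Q k\<close> maps \<open>V k\<close> into itself.\<close>
      unfolding T_eq by (rule form_sum_orthogonal[OF a_bilinear]) (use orth QV in auto)
    also have "\<dots> \<le> (\<Sum>k\<in>?K. c * a (R k u) (R k u))"
      using a_posdef_V Q_linear om R(1)
      by (intro sum_mono energy_le_if_omega_le[OF a_bilinear a_semidef]) auto
    also have "\<dots> = c * a u (T u)" by (simp only: aT sum_distrib_left)
    also have "\<dots> = c * (l * a u u)" by (simp only: u(3) bilinear_rmul[OF a_bilinear] real_scaleR_def)
    finally show ?thesis
      using a_posdef_X u(1,2) lower[OF l] by simp
  qed

  have min: "1 \<le> lambda_min X T" unfolding lambda_min_def using fin ne lower by simp
  have "ereal (lambda_max X T / lambda_min X T) \<le> omega a M V Q"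
  proof (rule ereal_le_real)
    fix c assume om: "omega a M V Q \<le> ereal c"
    have maxE: "lambda_max X T \<in> ?E" unfolding lambda_max_def using fin ne by (rule Max_in)
    have "lambda_max X T / lambda_min X T \<le> lambda_max X T / 1"
      using min lower[OF maxE] by (intro divide_left_mono) auto
    then show "ereal (lambda_max X T / lambda_min X T) \<le> ereal c"
      using upper[OF maxE om] by simp
  qed
  then show ?thesis using min unfolding T_def by simp
qed

end
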